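(* Let $(X,d,\mu)$ be a differentiability space. Then $\mu$ is pointwise doubling at $\mu$-almost every $x\in X$, and $(X,d,\mu)$ is a Vitali space.
   Context: Throughout, $(X,d)$ is a complete separable metric space equipped with a locally finite Borel measure $\mu$. A chart of dimension $n\in\mathbb{N}$ is a pair $(U,\varphi)$ with $U\subset X$ Borel and $\varphi\colon X\to\mathbb{R}^n$ Lipschitz. A function $f\colon X\to\mathbb{R}$ is differentiable with respect to $(U,\varphi)$ at $x_0\in U$ if there exists a unique $df(x_0)\in\mathbb{R}^n$ such that \[\limsup_{X\ni x\to x_0}\frac{|f(x)-f(x_0)-df(x_0)\cdot(\varphi(x)-\varphi(x_0))|}{d(x,x_0)}=0\] (limit over $x\ne x_0$). $(X,d,\mu)$ is a differentiability space (also called a Lipschitz differentiability space) if there is a countable decomposition of $X$ into charts such that every Lipschitz $f\colon X\to\mathbb{R}$ is differentiable at almost every point of every chart. $\mu$ is pointwise doubling at $x\in X$ if \[\limsup_{r\downarrow 0}\frac{\mu(B(x,2r))}{\mu(B(x,r))}<\infty.\] (Since $X$ is separable, $\mu(B(x,r))>0$ for all $r>0$ for almost every $x$.) $(X,d,\mu)$ is a Vitali space if for every $A\subset X$ and every family $\mathcal{B}$ of closed balls centred at points of $A$ such that $\inf\{r>0:\overline{B}(x,r)\in\mathcal{B}\}=0$ for each $x\in A$, there is a countable pairwise disjoint subfamily of $\mathcal{B}$ whose union covers $\mu$-almost all of $A$. *)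

theory Defs
  imports "HOL-Analysis.Analysis"
begin

definition locally_finite_borel_measure :: "'a::topological_space measure \<Rightarrow> bool" where
  "locally_finite_borel_measure M \<longleftrightarrow>
     sets M = sets borel \<and> (\<forall>x. \<exists>V. open V \<and> x \<in> V \<and> emeasure M V < \<infinity>)"

text \<open>
  Charts in one decomposition may have different dimensions, so \<open>\<real>\<^sup>n\<close> cannot be a type.  It is the
  carrier of the library's \<open>Euclidean_space n\<close>: the functions \<open>nat \<Rightarrow> real\<close> that vanish at every
  index \<open>i \<ge> n\<close>.  The Lipschitz condition refers to the Euclidean norm.  Dimension 0 is allowed.
\<close>

definition chart :: "nat \<Rightarrow> 'a::metric_space set \<Rightarrow> ('a \<Rightarrow> nat \<Rightarrow> real) \<Rightarrow> bool" where
  "chart n U \<phi> \<longleftrightarrow>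
     U \<in> sets borel \<and>
     range \<phi> \<subseteq> topspace (Euclidean_space n) \<and>
     (\<exists>L. \<forall>x y. L2_set (\<lambda>i. \<phi> x i - \<phi> y i) {..<n} \<le> L * dist x y)"

text \<open>
  The upper limit is taken in \<open>[0, \<infinity>]\<close>, so it is 0 at an isolated point.  There every vector
  is a derivative, and uniqueness then holds only when \<open>n = 0\<close>.
\<close>

definition differentiable_wrt ::
  "nat \<Rightarrow> ('a::metric_space \<Rightarrow> nat \<Rightarrow> real) \<Rightarrow> ('a \<Rightarrow> real) \<Rightarrow> 'a \<Rightarrow> bool" where
  "differentiable_wrt n \<phi> f x0 \<longleftrightarrow>
     (\<exists>!D. D \<in> topspace (Euclidean_space n) \<and>
        Limsup (at x0) (\<lambda>x. ennreal
          (\<bar>f x - f x0 - (\<Sum>i<n. D i * (\<phi> x i - \<phi> x0 i))\<bar> / dist x x0)) = 0)"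

text \<open>The sets \<open>U i\<close> may be empty, so finite decompositions are included.\<close>

definition differentiability_space :: "'a::metric_space measure \<Rightarrow> bool" where
  "differentiability_space M \<longleftrightarrow>
     (\<exists>(n :: nat \<Rightarrow> nat) (U :: nat \<Rightarrow> 'a set) (\<phi> :: nat \<Rightarrow> 'a \<Rightarrow> nat \<Rightarrow> real).
        (\<forall>i. chart (n i) (U i) (\<phi> i)) \<and>
        disjoint_family U \<and> (\<Union>i. U i) = UNIV \<and>
        (\<forall>f :: 'a \<Rightarrow> real. (\<exists>L. L-lipschitz_on UNIV f) \<longrightarrow>
           (\<forall>i. AE x in M. x \<in> U i \<longrightarrow> differentiable_wrt (n i) (\<phi> i) f x)))"

text \<open>
  In \<open>ennreal\<close>, \<open>0 / 0 = 0\<close>.  This affects only points having a ball of measure zero,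
  which form a null set in a separable space.
\<close>

definition pointwise_doubling_at :: "'a::metric_space measure \<Rightarrow> 'a \<Rightarrow> bool" where
  "pointwise_doubling_at M x \<longleftrightarrow>
     Limsup (at_right 0) (\<lambda>r::real. emeasure M (ball x (2 * r)) / emeasure M (ball x r)) < \<infinity>"

text \<open>
  The set \<open>A\<close> need not be measurable.  The infimum is taken in \<open>ereal\<close>, where the empty set has
  infimum \<open>\<infinity>\<close>; hence every point of \<open>A\<close> is the centre of some ball in \<open>\<B>\<close>.
\<close>

definition vitali_space :: "'a::metric_space measure \<Rightarrow> bool" where
  "vitali_space M \<longleftrightarrow>
     (\<forall>(A :: 'a set) (\<B> :: 'a set set).
        \<B> \<subseteq> {cball x r | x r. x \<in> A \<and> r > 0} \<and>
        (\<forall>x\<in>A. (INF r\<in>{r. r > 0 \<and> cball x r \<in> \<B>}. ereal r) = 0) \<longrightarrow>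
        (\<exists>\<C>\<subseteq>\<B>. countable \<C> \<and> disjoint \<C> \<and> (AE x in M. x \<in> A \<longrightarrow> x \<in> \<Union>\<C>)))"

end

theory Submission
  imports Defs
begin

text \<open>
  Both conclusions come from one property of a differentiability space: its porous sets are null
  (\<open>porous_null\<close>).  Here a set \<open>S\<close> is porous if every point of \<open>S\<close> sees, at arbitrarily small
  distances, balls that miss \<open>S\<close> and have radius comparable to their distance.

  \<^bold>\<open>Porous sets are null.\<close>  The function \<open>h = infdist _ S\<close> vanishes on \<open>S\<close> and is comparable to the
  distance in the holes near a point of \<open>S\<close>.  One such function may well be differentiable on \<open>S\<close>
  with nonzero derivative.  So \<open>h\<close> is cut, according to its values, into infinitely many Lipschitz
  pieces \<open>f\<^sub>0, f\<^sub>1, \<dots>\<close>, such that near almost every point of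
  \<open>S\<close> each piece is comparable to the distance in arbitrarily close holes in which all the others
  vanish.  If all the pieces were differentiable there with
  respect to an \<open>n\<close>-dimensional chart, then \<open>n + 1\<close> of their derivatives would be linearly dependent.
  The corresponding combination of the pieces would have derivative 0, but it is not \<open>o(dist)\<close>
  (\<open>interleaved_functions_not_differentiable\<close>).  The scales at which to cut are found by continuity
  of a finite measure and the Borel--Cantelli lemma (\<open>separated_scales\<close>): almost every point of \<open>S\<close>
  has holes in all but finitely many of them.

  \<^bold>\<open>Doubling.\<close>  At a point where doubling fails there are small radii \<open>r\<close> such that the ball of
  radius \<open>r\<close> has tiny measure compared with the ball of radius \<open>2 * r\<close>.  Choose disjoint double balls
  whose enlargements cover all such points.  The inner balls then have small total measure.  After
  their removal, at all scales, the set is porous, and hence null, while little has been removed.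

  \<^bold>\<open>Vitali property.\<close>  Extend a finite disjoint family repeatedly by a disjoint family of ever
  smaller balls whose enlargements cover the remaining points, keeping only finitely many of the
  new balls so that the rest has small measure.  A point that is never covered sees the new balls as holes at every stage, up to the small discarded part.

  The last two arguments share the lemma \<open>almost_porous_null\<close>: it suffices that the set misses
  the holes up to sets of arbitrarily small measure.
\<close>

section \<open>Selecting disjoint sets\<close>

text \<open>
  The combinatorial half of the basic covering theorem, with \<open>r\<close> in the role of the radius.  A family
  that is maximal among those which already dominate everything they meet cannot miss any set: a
  missed set of nearly maximal \<open>r\<close> could be added.
\<close>

lemma vitali_selection:
  fixes F :: "'i \<Rightarrow> 'b set" and r :: "'i \<Rightarrow> real"
  assumes ne: "\<And>i. i \<in> K \<Longrightarrow> F i \<noteq> {}" and pos: "\<And>i. i \<in> K \<Longrightarrow> 0 < r i"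
    and bdd: "\<And>i. i \<in> K \<Longrightarrow> r i \<le> R"
  obtains C where "C \<subseteq> K" "disjoint_family_on F C"
    "\<And>i. i \<in> K \<Longrightarrow> \<exists>j\<in>C. F i \<inter> F j \<noteq> {} \<and> r i \<le> 2 * r j"
proof -
  define \<A> where "\<A> = {C. C \<subseteq> K \<and> disjoint_family_on F C \<and>
      (\<forall>i\<in>K. (\<exists>j\<in>C. F i \<inter> F j \<noteq> {}) \<longrightarrow> (\<exists>j\<in>C. F i \<inter> F j \<noteq> {} \<and> r i \<le> 2 * r j))}"
  have "\<exists>C\<in>\<A>. \<forall>X\<in>\<A>. C \<subseteq> X \<longrightarrow> X = C"
  proof (rule subset_Zorn')
    fix \<C> assume chain: "subset.chain \<A> \<C>"
    have sub: "\<C> \<subseteq> \<A>" and lin: "\<And>X Y. X \<in> \<C> \<Longrightarrow> Y \<in> \<C> \<Longrightarrow> X \<subseteq> Y \<or> Y \<subseteq> X"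
      using chain unfolding subset_chain_def by auto
    have "disjoint_family_on F (\<Union>\<C>)"
      unfolding disjoint_family_on_def
    proof (intro ballI impI)
      fix i j assume "i \<in> \<Union>\<C>" "j \<in> \<Union>\<C>" and ij: "i \<noteq> j"
      then obtain X where "X \<in> \<C>" "i \<in> X" "j \<in> X" using lin by blast
      then show "F i \<inter> F j = {}"
        using sub ij unfolding \<A>_def disjoint_family_on_def by blast
    qed
    moreover have "\<exists>j\<in>\<Union>\<C>. F i \<inter> F j \<noteq> {} \<and> r i \<le> 2 * r j"
      if "i \<in> K" and meets: "\<exists>j\<in>\<Union>\<C>. F i \<inter> F j \<noteq> {}" for i
    proof -
      obtain X j where "X \<in> \<C>" "j \<in> X" "F i \<inter> F j \<noteq> {}" using meets by blast
      moreover have "X \<in> \<A>" using sub \<open>X \<in> \<C>\<close> by blast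
      ultimately have "\<exists>j\<in>X. F i \<inter> F j \<noteq> {} \<and> r i \<le> 2 * r j"
        using \<open>i \<in> K\<close> unfolding \<A>_def by blast
      then show ?thesis using \<open>X \<in> \<C>\<close> by blast
    qed
    ultimately show "\<Union>\<C> \<in> \<A>" using sub unfolding \<A>_def by blast
  qed
  then obtain C where C: "C \<in> \<A>" and max: "\<And>X. X \<in> \<A> \<Longrightarrow> C \<subseteq> X \<Longrightarrow> X = C" by blast
  have CK: "C \<subseteq> K" and disj: "disjoint_family_on F C"
    and dom: "\<And>i. i \<in> K \<Longrightarrow> \<exists>j\<in>C. F i \<inter> F j \<noteq> {} \<Longrightarrow> \<exists>j\<in>C. F i \<inter> F j \<noteq> {} \<and> r i \<le> 2 * r j"
    using C unfolding \<A>_def by blast+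
  define L where "L = {i\<in>K. \<forall>j\<in>C. F i \<inter> F j = {}}"
  have "L = {}"
  proof (rule ccontr)
    assume "L \<noteq> {}"
    then obtain l where l: "l \<in> L" by blast
    have bddL: "bdd_above (r ` L)" using bdd unfolding L_def by (auto intro!: bdd_aboveI[of _ R])
    define s where "s = (SUP i\<in>L. r i)"
    have le_s: "r i \<le> s" if "i \<in> L" for i
      unfolding s_def using bddL that by (rule cSUP_upper2[OF _ _ order_refl])
    have "0 < s" using le_s[OF l] pos[of l] l unfolding L_def by auto
    then have "s / 2 < (SUP i\<in>L. r i)" unfolding s_def by simp
    then obtain p where p: "p \<in> L" "s / 2 < r p"
      using less_cSUP_iff[OF \<open>L \<noteq> {}\<close> bddL] by blast
    have pK: "p \<in> K" and p_apart: "\<And>j. j \<in> C \<Longrightarrow> F p \<inter> F j = {}" using p(1) unfolding L_def by auto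
    have "insert p C \<in> \<A>"
      unfolding \<A>_def mem_Collect_eq
    proof (intro conjI ballI impI)
      show "insert p C \<subseteq> K" using CK pK by blast
      show "disjoint_family_on F (insert p C)"
        using disj p_apart unfolding disjoint_family_on_def by (auto simp: Int_commute)
      fix i assume i: "i \<in> K" "\<exists>j\<in>insert p C. F i \<inter> F j \<noteq> {}"
      show "\<exists>j\<in>insert p C. F i \<inter> F j \<noteq> {} \<and> r i \<le> 2 * r j"
      proof (cases "i \<in> L")
        case True
        then have "F i \<inter> F p \<noteq> {}" using i(2) unfolding L_def by blast
        moreover have "r i \<le> 2 * r p" using le_s[OF True] p(2) by simp
        ultimately show ?thesis by blast
      next
        case False
        then show ?thesis using dom[OF i(1)] i(1) unfolding L_def by blast
      qed
    qed
    then have "insert p C = C" using max by blast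
    then show False using p_apart[of p] ne[OF pK] by blast
  qed
  then have "\<exists>j\<in>C. F i \<inter> F j \<noteq> {} \<and> r i \<le> 2 * r j" if "i \<in> K" for i
    using dom that unfolding L_def by blast
  with CK disj show ?thesis using that by blast
qed

section \<open>Functions that cannot all be differentiable at a point\<close>

lemma linear_relation:
  fixes D :: "'i \<Rightarrow> nat \<Rightarrow> real"
  assumes "finite I" "n < card I"
  shows "\<exists>c. (\<exists>i\<in>I. c i \<noteq> 0) \<and> (\<forall>l<n. (\<Sum>i\<in>I. c i * D i l) = 0)"
  using assms
proof (induction n arbitrary: I D)
  case 0
  then have "I \<noteq> {}" by auto
  then show ?case by (intro exI[of _ "\<lambda>_. 1"]) auto
next
  case (Suc n)
  show ?case
  proof (cases "\<exists>p\<in>I. D p n \<noteq> 0")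
    case False
    obtain c where "\<exists>i\<in>I. c i \<noteq> 0" "\<forall>l<n. (\<Sum>i\<in>I. c i * D i l) = 0"
      using Suc.IH[of I D] Suc.prems by auto
    moreover have "(\<Sum>i\<in>I. c i * D i n) = 0" using False by (intro sum.neutral) auto
    ultimately show ?thesis by (intro exI[of _ c]) (auto simp: less_Suc_eq)
  next
    case True
    then obtain p where p: "p \<in> I" "D p n \<noteq> 0" by blast
    define J where "J = I - {p}"
    have J: "finite J" "p \<notin> J" "I = insert p J" using p Suc.prems unfolding J_def by auto
    have "n < card J" using Suc.prems J by simp
    then obtain c where c: "\<exists>i\<in>J. c i \<noteq> 0"
      "\<And>l. l < n \<Longrightarrow> (\<Sum>i\<in>J. c i * (D i l - D i n / D p n * D p l)) = 0"
      using Suc.IH[of J "\<lambda>i l. D i l - D i n / D p n * D p l"] J by blast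
    define c' where "c' = c(p := - (\<Sum>i\<in>J. c i * D i n) / D p n)"
    have sum: "(\<Sum>i\<in>I. c' i * D i l) = (\<Sum>i\<in>J. c i * (D i l - D i n / D p n * D p l))" for l
    proof -
      have "(\<Sum>i\<in>I. c' i * D i l) = c' p * D p l + (\<Sum>i\<in>J. c' i * D i l)" using J by simp
      also have "(\<Sum>i\<in>J. c' i * D i l) = (\<Sum>i\<in>J. c i * D i l)"
        using J(2) by (intro sum.cong) (auto simp: c'_def)
      also have "c' p * D p l = - (\<Sum>i\<in>J. c i * (D i n / D p n * D p l))"
        by (simp add: c'_def sum_distrib_left sum_distrib_right sum_divide_distrib mult_ac)
      finally show ?thesis by (simp add: sum_subtractf right_diff_distrib)
    qed
    have "(\<Sum>i\<in>I. c' i * D i l) = 0" if "l < Suc n" for l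
      unfolding sum using c(2)[of l] p(2) that by (cases "l = n") auto
    moreover have "\<exists>i\<in>I. c' i \<noteq> 0" using c(1) J by (auto simp: c'_def)
    ultimately show ?thesis by blast
  qed
qed

text \<open>
  Suitable linear combinations of the \<open>f i\<close> have derivative 0, and at a peak of one of the functions
  involved such a combination reduces to a single term comparable to the distance.  Infinitely many
  functions are supplied so that the same family serves charts of every dimension \<open>n\<close>.
\<close>

lemma interleaved_functions_not_differentiable:
  fixes f :: "nat \<Rightarrow> 'a::metric_space \<Rightarrow> real"
  assumes zero: "\<And>i. f i x0 = 0" and \<delta>: "0 < \<delta>"
    and peaks: "\<And>i e. 0 < e \<Longrightarrow>
      \<exists>y. 0 < dist y x0 \<and> dist y x0 < e \<and> \<delta> * dist y x0 \<le> f i y \<and> (\<forall>j. j \<noteq> i \<longrightarrow> f j y = 0)"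
  shows "\<exists>i. \<not> differentiable_wrt n \<phi> (f i) x0"
proof (rule ccontr)
  assume "\<not> ?thesis"
  then have diff: "differentiable_wrt n \<phi> (f i) x0" for i by blast
  have "\<exists>D. Limsup (at x0) (\<lambda>y. ennreal
       (\<bar>f i y - f i x0 - (\<Sum>l<n. D l * (\<phi> y l - \<phi> x0 l))\<bar> / dist y x0)) = 0" for i
    using diff[of i] unfolding differentiable_wrt_def by (elim ex1E conjE, intro exI)
  then have "\<exists>D. \<forall>i. Limsup (at x0) (\<lambda>y. ennreal
       (\<bar>f i y - f i x0 - (\<Sum>l<n. D i l * (\<phi> y l - \<phi> x0 l))\<bar> / dist y x0)) = 0"
    by (intro choice allI)
  then obtain D where D: "\<And>i. Limsup (at x0) (\<lambda>y. ennreal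
       (\<bar>f i y - f i x0 - (\<Sum>l<n. D i l * (\<phi> y l - \<phi> x0 l))\<bar> / dist y x0)) = 0"
    by (elim exE) (rule that, erule spec)
  define \<rho> where "\<rho> i y = f i y - (\<Sum>l<n. D i l * (\<phi> y l - \<phi> x0 l))" for i y
  have small: "eventually (\<lambda>y. \<bar>\<rho> i y\<bar> \<le> \<eta> * dist y x0) (at x0)" if "0 < \<eta>" for i \<eta>
  proof -
    have "eventually (\<lambda>y. ennreal (\<bar>\<rho> i y\<bar> / dist y x0) < ennreal \<eta>) (at x0)"
      using D[of i] that zero unfolding \<rho>_def by (intro Limsup_lessD) simp
    then show ?thesis
      unfolding eventually_at
      using that by (auto simp: ennreal_less_iff divide_less_eq less_imp_le)
  qed
  \<comment> \<open>The \<open>n + 1\<close> derivatives \<open>D 0, \<dots>, D n\<close> live in dimension \<open>n\<close>.\<close>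
  obtain c where c: "\<exists>i\<in>{..n}. c i \<noteq> 0" "\<And>l. l < n \<Longrightarrow> (\<Sum>i\<le>n. c i * D i l) = 0"
    using linear_relation[of "{..n}" n D] by auto
  then obtain p where p: "p \<le> n" "c p \<noteq> 0" by auto
  have combine: "(\<Sum>i\<le>n. c i * f i y) = (\<Sum>i\<le>n. c i * \<rho> i y)" for y
  proof -
    have "(\<Sum>i\<le>n. c i * (\<Sum>l<n. D i l * (\<phi> y l - \<phi> x0 l)))
        = (\<Sum>l<n. (\<Sum>i\<le>n. c i * D i l) * (\<phi> y l - \<phi> x0 l))"
      unfolding sum_distrib_left sum_distrib_right by (subst sum.swap) (simp add: mult_ac)
    also have "\<dots> = 0" using c(2) by simp
    finally show ?thesis unfolding \<rho>_def by (simp add: right_diff_distrib sum_subtractf)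
  qed
  define W where "W = (\<Sum>i\<le>n. \<bar>c i\<bar>)"
  have "\<bar>c p\<bar> \<le> W" unfolding W_def using p(1) by (intro member_le_sum) auto
  then have W: "0 < W" using p(2) by linarith
  \<comment> \<open>Errors of this size add up to half of the lower bound \<open>\<bar>c p\<bar> * \<delta> * dist y x0\<close> at a peak of \<open>f p\<close>.\<close>
  define \<eta> where "\<eta> = \<bar>c p\<bar> * \<delta> / (2 * W)"
  have \<eta>: "0 < \<eta>" using p(2) \<delta> W by (simp add: \<eta>_def)
  have "eventually (\<lambda>y. \<forall>i\<in>{..n}. \<bar>\<rho> i y\<bar> \<le> \<eta> * dist y x0) (at x0)"
    using small[OF \<eta>] by (intro eventually_ball_finite) auto
  then obtain e where e: "0 < e"
    "\<And>y i. y \<noteq> x0 \<Longrightarrow> dist y x0 < e \<Longrightarrow> i \<le> n \<Longrightarrow> \<bar>\<rho> i y\<bar> \<le> \<eta> * dist y x0"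
    unfolding eventually_at by auto
  obtain y where y: "0 < dist y x0" "dist y x0 < e" "\<delta> * dist y x0 \<le> f p y" "\<And>j. j \<noteq> p \<Longrightarrow> f j y = 0"
    using peaks[OF e(1), of p] by blast
  have "\<bar>c p\<bar> * (\<delta> * dist y x0) \<le> \<bar>c p\<bar> * \<bar>f p y\<bar>" using y(3) by (intro mult_left_mono) auto
  also have "\<dots> = \<bar>\<Sum>i\<le>n. c i * f i y\<bar>"
  proof -
    have "(\<Sum>i\<le>n. c i * f i y) = (\<Sum>i\<in>{p}. c i * f i y)"
      using p(1) y(4) by (intro sum.mono_neutral_right) auto
    then show ?thesis by (simp add: abs_mult)
  qed
  also have "\<dots> \<le> (\<Sum>i\<le>n. \<bar>c i\<bar> * (\<eta> * dist y x0))"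
    unfolding combine
  proof (rule order_trans[OF sum_abs], rule sum_mono)
    fix i assume "i \<in> {..n}"
    then have "\<bar>\<rho> i y\<bar> \<le> \<eta> * dist y x0" using y(1,2) e(2) by auto
    then show "\<bar>c i * \<rho> i y\<bar> \<le> \<bar>c i\<bar> * (\<eta> * dist y x0)"
      unfolding abs_mult by (intro mult_left_mono) auto
  qed
  also have "\<dots> = W * \<eta> * dist y x0" by (simp add: W_def sum_distrib_right mult.assoc)
  also have "\<dots> = \<bar>c p\<bar> * \<delta> * dist y x0 / 2" using W by (simp add: \<eta>_def)
  finally show False using y(1) p(2) \<delta> by simp
qed

section \<open>Porous sets are null\<close>

text \<open>
  \<open>T x\<close> is the set of scales observed at \<open>x\<close>.  Given \<open>e k\<close>, the points with a scale in \<open>(0, e k)\<close> but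
  none in \<open>(a k, e k)\<close> decrease to the empty set as \<open>a k\<close> tends to 0, so \<open>a k\<close> can be chosen
  to make their measure at most \<open>2\<^sup>-\<^sup>k\<close>.  The Borel--Cantelli lemma then applies.  The factor 4 in the
  last bound on \<open>e m\<close> keeps the enlarged intervals \<open>(a k / 2, 2 * e k)\<close> disjoint.
\<close>

lemma (in finite_measure) separated_scales:
  fixes T :: "'a \<Rightarrow> real set"
  assumes meas: "\<And>a b. {x\<in>space M. T x \<inter> {a<..<b} \<noteq> {}} \<in> sets M"
  obtains a e where "\<And>k::nat. 0 < a k" "\<And>k. a k < e k" "\<And>k. e k \<le> 1 / real (Suc k)"
    "\<And>k m. k < m \<Longrightarrow> e m \<le> a k / 4"
    "AE x in M. (\<forall>b>0. T x \<inter> {0<..<b} \<noteq> {}) \<longrightarrow>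
       (\<forall>\<^sub>F k in sequentially. T x \<inter> {a k<..<e k} \<noteq> {})"
proof -
  define S where "S a b = {x\<in>space M. T x \<inter> {a<..<b} \<noteq> {}}" for a b
  have S[measurable]: "S a b \<in> sets M" for a b unfolding S_def by (rule meas)
  have step: "\<exists>a. 0 < a \<and> a < b \<and> measure M (S 0 b - S a b) \<le> (1/2)^k"
    if b: "0 < b" for b and k :: nat
  proof -
    define A where "A i = S 0 b - S (b / real (i + 2)) b" for i :: nat
    have "decseq A"
    proof (rule decseq_SucI)
      fix i
      have "b / real (Suc i + 2) \<le> b / real (i + 2)" using b by (intro divide_left_mono) auto
      then have "S (b / real (i + 2)) b \<subseteq> S (b / real (Suc i + 2)) b"
        unfolding S_def by fastforce
      then show "A (Suc i) \<le> A i" unfolding A_def by blast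
    qed
    moreover have "(\<Inter>i. A i) = {}"
    proof -
      have False if x: "\<And>i. x \<in> A i" for x
      proof -
        obtain t where t: "t \<in> T x" "0 < t" "t < b" using x[of 0] unfolding A_def S_def by auto
        obtain i :: nat where i: "b / t < real i" using reals_Archimedean2 by blast
        have "b < t * real (i + 2)"
          using i t(2) by (simp add: field_simps)
        then have "b / real (i + 2) < t" by (simp add: divide_less_eq)
        moreover have "x \<in> space M" using x[of i] unfolding A_def S_def by auto
        ultimately have "x \<in> S (b / real (i + 2)) b" using t unfolding S_def by auto
        then show False using x[of i] unfolding A_def by blast
      qed
      then show ?thesis by blast
    qed
    moreover have "range A \<subseteq> sets M" unfolding A_def by auto
    ultimately have "(\<lambda>i. measure M (A i)) \<longlonglongrightarrow> 0"
      using finite_Lim_measure_decseq[of A] by simp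
    then have "\<forall>\<^sub>F i in sequentially. measure M (A i) < (1/2)^k"
      by (rule order_tendstoD) simp
    then obtain i where "measure M (A i) < (1/2)^k" by (auto simp: eventually_sequentially)
    moreover have "b / real (i + 2) < b" using b by (simp add: divide_less_eq)
    ultimately show ?thesis
      using b unfolding A_def by (intro exI[of _ "b / real (i + 2)"]) auto
  qed
  define P where "P k p \<longleftrightarrow> 0 < fst p \<and> fst p < snd p \<and> snd p \<le> 1 / real (Suc k) \<and>
      measure M (S 0 (snd p) - S (fst p) (snd p)) \<le> (1/2)^k" for k :: nat and p :: "real \<times> real"
  have "\<exists>g. \<forall>k. P k (g k) \<and> snd (g (Suc k)) \<le> fst (g k) / 4"
  proof (rule dependent_nat_choice)
    show "\<exists>p. P 0 p" using step[of 1 0] unfolding P_def by auto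
    fix p k assume "P k p"
    then have "0 < min (fst p / 4) (1 / real (Suc (Suc k)))" unfolding P_def by auto
    from step[OF this, of "Suc k"]
    show "\<exists>q. P (Suc k) q \<and> snd q \<le> fst p / 4"
      unfolding P_def by (metis fst_conv min.cobounded1 min.cobounded2 snd_conv)
  qed
  then obtain g where g: "\<And>k. P k (g k)" "\<And>k. snd (g (Suc k)) \<le> fst (g k) / 4" by blast
  define a e where "a k = fst (g k)" and "e k = snd (g k)" for k
  have ae: "0 < a k" "a k < e k" "e k \<le> 1 / real (Suc k)"
      "measure M (S 0 (e k) - S (a k) (e k)) \<le> (1/2)^k" "e (Suc k) \<le> a k / 4" for k
    using g[of k] unfolding P_def a_def e_def by auto
  have "e (Suc k) \<le> e k" for k using ae(1,2,5)[of k] by linarith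
  then have dec: "decseq e" by (rule decseq_SucI)
  have far: "e m \<le> a k / 4" if "k < m" for k m
    using decseqD[OF dec, of "Suc k" m] ae(5)[of k] that by simp
  have "AE x in M. \<forall>\<^sub>F k in sequentially. x \<in> space M - (S 0 (e k) - S (a k) (e k))"
  proof (rule borel_cantelli_AE1)
    show "summable (\<lambda>k. measure M (S 0 (e k) - S (a k) (e k)))"
      using ae(4) by (intro summable_comparison_test'[OF summable_geometric[of "1/2"], of 0]) auto
  qed (auto simp: less_top[symmetric])
  then have "AE x in M. (\<forall>b>0. T x \<inter> {0<..<b} \<noteq> {}) \<longrightarrow>
       (\<forall>\<^sub>F k in sequentially. T x \<inter> {a k<..<e k} \<noteq> {})"
  proof (rule AE_mp[OF _ AE_I2], intro impI)
    fix x assume *: "x \<in> space M"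
      "\<forall>\<^sub>F k in sequentially. x \<in> space M - (S 0 (e k) - S (a k) (e k))"
      "\<forall>b>0. T x \<inter> {0<..<b} \<noteq> {}"
    have "T x \<inter> {0<..<e k} \<noteq> {}" for k using *(3) ae(1,2)[of k] by (metis order_less_trans)
    with *(1) have "x \<in> S 0 (e k)" for k unfolding S_def by blast
    with *(2) show "\<forall>\<^sub>F k in sequentially. T x \<inter> {a k<..<e k} \<noteq> {}"
      unfolding S_def by (auto elim!: eventually_mono)
  qed
  then show ?thesis using that ae(1-3) far by blast
qed

text \<open>
  The constant \<open>c\<close> bounds the distance to the centre of a hole in terms of its radius and is the same
  for all points of the set.
\<close>

definition porous :: "real \<Rightarrow> 'a::metric_space set \<Rightarrow> bool" where
  "porous c S \<longleftrightarrow> (\<forall>x\<in>S. \<forall>\<epsilon>>0. \<exists>y s. dist x y < \<epsilon> \<and> dist x y \<le> c * s \<and> 0 < s \<and> ball y s \<inter> S = {})"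

text \<open>
  The pieces are \<open>f i = infdist (h _) (Z i)\<close>, where \<open>Z i\<close> is the complement of infinitely many of the
  intervals \<open>(a k / 2, 2 * e k)\<close> of separated scales.  As a composition of distance functions, \<open>f i\<close>
  is 1-Lipschitz.  It is at least \<open>h / 2\<close> where \<open>h\<close> lies in one of its own intervals
  \<open>(a k, e k)\<close>, and 0 where \<open>h\<close> lies in an interval that belongs to another index.
\<close>

lemma porous_null:
  fixes M :: "'a::metric_space measure"
  assumes fin: "finite_measure M" and sets: "sets M = sets borel"
    and diff: "differentiability_space M" and por: "porous c S"
  shows "AE x in M. x \<notin> S"
proof (cases "S = {}")
  case True
  then show ?thesis by simp
next
  case False
  interpret finite_measure M by (rule fin)
  have space: "space M = UNIV" using sets_eq_imp_space_eq[OF sets] by simp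
  define h where "h y = infdist y S" for y
  define C where "C = max c 0 + 1"
  have C: "0 < C" "c < C" unfolding C_def by auto
  define T where "T x = {t. \<exists>y. h y = t \<and> dist x y < C * t}" for x
  have T_small: "T x \<inter> {0<..<b} \<noteq> {}" if xb: "x \<in> S" "0 < b" for x b
  proof -
    obtain y s where y: "dist x y < b" "dist x y \<le> c * s" "0 < s" "ball y s \<inter> S = {}"
      using por xb unfolding porous_def by blast
    have "s \<le> h y"
      unfolding h_def infdist_notempty[OF False] using y(4)
      by (intro cINF_greatest[OF False]) (auto simp: disjoint_iff not_less)
    have "h y \<le> dist y x" unfolding h_def using xb by (intro infdist_le)
    moreover have "dist x y < C * h y"
    proof -
      have "c * s \<le> max c 0 * h y"
        using y(3) \<open>s \<le> h y\<close> by (intro mult_mono) auto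
      also have "\<dots> < C * h y" using y(3) \<open>s \<le> h y\<close> unfolding C_def by (simp add: ring_distribs)
      finally show ?thesis using y(2) by simp
    qed
    ultimately have "h y \<in> T x" "h y \<in> {0<..<b}"
      using y(1,3) \<open>s \<le> h y\<close> unfolding T_def by (auto simp: dist_commute)
    then show ?thesis by blast
  qed
  have "{x\<in>space M. T x \<inter> {a<..<b} \<noteq> {}} = (\<Union>y\<in>{y. a < h y \<and> h y < b}. ball y (C * h y))"
    (is "?L = ?R") for a b
  proof (intro set_eqI iffI)
    fix x assume "x \<in> ?L"
    then show "x \<in> ?R" unfolding T_def by (auto simp: dist_commute)
  next
    fix x assume "x \<in> ?R"
    then obtain y where "h y \<in> {a<..<b}" "h y \<in> T x" unfolding T_def by (auto simp: dist_commute)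
    then show "x \<in> ?L" unfolding space by blast
  qed
  then have "{x\<in>space M. T x \<inter> {a<..<b} \<noteq> {}} \<in> sets M" for a b
    unfolding sets by (auto intro!: borel_open)
  then obtain a e where ae: "\<And>k::nat. 0 < a k" "\<And>k. a k < e k" "\<And>k. e k \<le> 1 / real (Suc k)"
    "\<And>k m. k < m \<Longrightarrow> e m \<le> a k / 4" and
    AE_T: "AE x in M. (\<forall>b>0. T x \<inter> {0<..<b} \<noteq> {}) \<longrightarrow>
       (\<forall>\<^sub>F k in sequentially. T x \<inter> {a k<..<e k} \<noteq> {})"
    using separated_scales[of T] by blast
  define I where "I k = {a k / 2 <..< 2 * e k}" for k
  have I_disj: "I k \<inter> I m = {}" if "k \<noteq> m" for k m
  proof -
    have "I k \<inter> I m = {}" if "k < m" for k m using ae(4)[OF that] unfolding I_def by auto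
    then show ?thesis using that by (metis Int_commute linorder_neq_iff)
  qed
  \<comment> \<open>Decoding pairs assigns infinitely many of the intervals to each index \<open>i\<close>.\<close>
  define Z where "Z i = - (\<Union>k\<in>{k. fst (prod_decode k) = i}. I k)" for i
  define f where "f i y = infdist (h y) (Z i)" for i y
  have "0 \<notin> I k" for k using ae(1)[of k] unfolding I_def by auto
  then have Z0: "0 \<in> Z i" for i unfolding Z_def by blast
  have lip: "1-lipschitz_on UNIV (f i)" for i
  proof (rule lipschitz_onI)
    fix y z
    have "dist (f i y) (f i z) \<le> dist (h y) (h z)"
      unfolding f_def dist_real_def[of "infdist _ _"] by (rule infdist_triangle_abs)
    also have "\<dots> \<le> 1 * dist y z"
      unfolding h_def dist_real_def using infdist_triangle_abs by simp
    finally show "dist (f i y) (f i z) \<le> 1 * dist y z" .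
  qed simp
  have f_peak: "h y / 2 \<le> f i y" if k: "fst (prod_decode k) = i" and y: "a k < h y" "h y < e k" for k i y
    unfolding f_def infdist_notempty[OF ex_in_conv[THEN iffD1, OF exI[of "\<lambda>z. z \<in> Z i", OF Z0]]]
  proof (rule cINF_greatest)
    fix z assume "z \<in> Z i"
    then have "z \<notin> I k" using k unfolding Z_def by blast
    then show "h y / 2 \<le> dist (h y) z" using y ae(1)[of k] unfolding I_def dist_real_def by auto
  qed (use Z0 in auto)
  have f_zero: "f j y = 0" if k: "fst (prod_decode k) = i" and y: "a k < h y" "h y < e k" and "j \<noteq> i"
    for k i j y
  proof -
    have "h y \<in> I k" using y ae(1)[of k] unfolding I_def by auto
    then have "h y \<notin> I m" if "fst (prod_decode m) = j" for m using I_disj[of k m] that k \<open>j \<noteq> i\<close> by blast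
    then have "h y \<in> Z j" unfolding Z_def by blast
    then show ?thesis unfolding f_def by simp
  qed
  obtain n :: "nat \<Rightarrow> nat" and U \<phi> where U: "(\<Union>i. U i) = (UNIV::'a set)"
    and D: "\<forall>f::'a \<Rightarrow> real. (\<exists>L. L-lipschitz_on UNIV f) \<longrightarrow>
         (\<forall>i. AE x in M. x \<in> U i \<longrightarrow> differentiable_wrt (n i) (\<phi> i) f x)"
    using diff unfolding differentiability_space_def by (elim exE conjE) (rule that, assumption+)
  have "\<forall>m. AE x in M. x \<in> U m \<longrightarrow> differentiable_wrt (n m) (\<phi> m) (f j) x" for j
    by (rule mp[OF spec[OF D]], rule exI, rule lip)
  then have "AE x in M. \<forall>j m. x \<in> U m \<longrightarrow> differentiable_wrt (n m) (\<phi> m) (f j) x"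
    unfolding AE_all_countable by simp
  with AE_T show ?thesis
  proof eventually_elim
    fix x
    assume T: "(\<forall>b>0. T x \<inter> {0<..<b} \<noteq> {}) \<longrightarrow> (\<forall>\<^sub>F k in sequentially. T x \<inter> {a k<..<e k} \<noteq> {})"
      and dx: "\<forall>j m. x \<in> U m \<longrightarrow> differentiable_wrt (n m) (\<phi> m) (f j) x"
    show "x \<notin> S"
    proof
      assume x: "x \<in> S"
      obtain m where m: "x \<in> U m" using U by blast
      have hx: "h x = 0" unfolding h_def using x by simp
      obtain K where K: "\<And>k. K \<le> k \<Longrightarrow> T x \<inter> {a k<..<e k} \<noteq> {}"
        using T T_small[OF x] unfolding eventually_sequentially by blast
      have "\<exists>i. \<not> differentiable_wrt (n m) (\<phi> m) (f i) x"
      proof (rule interleaved_functions_not_differentiable)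
        show "f i x = 0" for i unfolding f_def hx using Z0 by simp
        show "0 < 1 / (2 * C)" using C by simp
        fix i and \<epsilon> :: real assume \<epsilon>: "0 < \<epsilon>"
        \<comment> \<open>An interval of index \<open>i\<close> so far out that it contains a scale of \<open>x\<close> and forces \<open>dist y x < \<epsilon>\<close>.\<close>
        obtain q where q: "C / \<epsilon> < real q" using reals_Archimedean2 by blast
        define k where "k = prod_encode (i, max K q)"
        have "max K q \<le> k" unfolding k_def by (rule le_prod_encode_2)
        then obtain y where y: "a k < h y" "h y < e k" "dist x y < C * h y"
          using K[of k] unfolding T_def by auto
        have "h y < 1 / real (Suc k)" using y(2) ae(3)[of k] by linarith
        then have "C * h y < C * (1 / real (Suc k))" using C(1) by (rule mult_strict_left_mono)
        also have "C * (1 / real (Suc k)) \<le> \<epsilon>"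
        proof -
          have "C / \<epsilon> < real (Suc k)" using q \<open>max K q \<le> k\<close> by linarith
          then show ?thesis using \<epsilon> by (simp add: field_simps)
        qed
        finally have "dist y x < \<epsilon>" using y(3) by (simp add: dist_commute)
        moreover have "y \<noteq> x" using y(1) ae(1)[of k] hx by auto
        moreover have "1 / (2 * C) * dist y x \<le> f i y"
        proof -
          have "1 / (2 * C) * dist y x \<le> h y / 2" using y(3) C(1) by (simp add: field_simps dist_commute)
          also have "\<dots> \<le> f i y" using f_peak[of k i y] y by (simp add: k_def)
          finally show ?thesis .
        qed
        moreover have "\<forall>j. j \<noteq> i \<longrightarrow> f j y = 0" using f_zero[of k i y] y by (simp add: k_def)
        ultimately show "\<exists>y. 0 < dist y x \<and> dist y x < \<epsilon> \<and> 1 / (2 * C) * dist y x \<le> f i y \<and>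
            (\<forall>j. j \<noteq> i \<longrightarrow> f j y = 0)" by auto
      qed
      then show False using dx m by blast
    qed
  qed
qed


text \<open>
  Take the exceptional sets \<open>E k\<close> for \<open>\<epsilon> = 2\<^sup>-\<^sup>k\<close>.  Outside the union of the \<open>E k\<close> with \<open>k \<ge> m\<close> the set
  \<open>A\<close> is porous, and by the Borel--Cantelli lemma almost every point lies in only finitely many \<open>E k\<close>.
\<close>

lemma almost_porous_null:
  fixes M :: "'a::metric_space measure"
  assumes null: "\<And>S. porous c S \<Longrightarrow> AE x in M. x \<notin> S"
    and almost: "\<And>\<epsilon>::real. 0 < \<epsilon> \<Longrightarrow> \<exists>H E. E \<in> sets M \<and> emeasure M E \<le> ennreal \<epsilon> \<and>
        (\<forall>(y, s)\<in>H. 0 < s \<and> s \<le> \<epsilon> \<and> ball y s \<inter> A \<subseteq> E) \<and> (\<forall>x\<in>A. \<exists>(y, s)\<in>H. dist x y \<le> c * s)"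
  shows "AE x in M. x \<notin> A"
proof -
  define Q where "Q k H E \<longleftrightarrow> E \<in> sets M \<and> emeasure M E \<le> ennreal ((1/2)^k) \<and>
        (\<forall>(y, s)\<in>H. 0 < s \<and> s \<le> (1/2)^k \<and> ball y s \<inter> A \<subseteq> E) \<and> (\<forall>x\<in>A. \<exists>(y, s)\<in>H. dist x y \<le> c * s)"
    for k :: nat and H E
  have "\<forall>k. \<exists>H E. Q k H E" using almost unfolding Q_def by simp
  then obtain H E where HE: "\<And>k. Q k (H k) (E k)" by metis
  have E: "E k \<in> sets M" "emeasure M (E k) \<le> ennreal ((1/2)^k)" for k
    using HE[of k] unfolding Q_def by auto
  have H: "0 < s \<and> s \<le> (1/2)^k \<and> ball y s \<inter> A \<subseteq> E k" if "(y, s) \<in> H k" for k y s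
    using HE[of k] that unfolding Q_def by blast
  have cover: "\<exists>y s. (y, s) \<in> H k \<and> dist x y \<le> c * s" if "x \<in> A" for k x
    using HE[of k] that unfolding Q_def by blast
  have "porous c (A - (\<Union>k\<in>{m..}. E k))" for m
    unfolding porous_def
  proof (intro ballI allI impI)
    fix x and \<epsilon> :: real assume x: "x \<in> A - (\<Union>k\<in>{m..}. E k)" and \<epsilon>: "0 < \<epsilon>"
    have "(\<lambda>k. \<bar>c\<bar> * (1/2)^k) \<longlonglongrightarrow> 0"
      by (intro tendsto_mult_right_zero LIMSEQ_realpow_zero) auto
    then have "\<forall>\<^sub>F k in sequentially. \<bar>c\<bar> * (1/2)^k < \<epsilon>" using \<epsilon> by (rule order_tendstoD)
    then have "\<forall>\<^sub>F k in sequentially. m \<le> k \<and> \<bar>c\<bar> * (1/2)^k < \<epsilon>"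
      by (intro eventually_conj eventually_ge_at_top)
    then obtain k where k: "m \<le> k" "\<bar>c\<bar> * (1/2)^k < \<epsilon>"
      by (auto simp: eventually_sequentially)
    obtain y s where ys: "(y, s) \<in> H k" "dist x y \<le> c * s" using cover[of x k] x by blast
    have "c * s \<le> \<bar>c\<bar> * (1/2)^k" using H[OF ys(1)] by (intro mult_mono) auto
    then have "dist x y < \<epsilon>" using ys(2) k(2) by simp
    moreover have "ball y s \<inter> (A - (\<Union>k\<in>{m..}. E k)) = {}" using H[OF ys(1)] k(1) by auto
    ultimately show "\<exists>y s. dist x y < \<epsilon> \<and> dist x y \<le> c * s \<and> 0 < s \<and> ball y s \<inter> (A - (\<Union>k\<in>{m..}. E k)) = {}"
      using H[OF ys(1)] ys(2) by blast
  qed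
  then have "AE x in M. \<forall>m. x \<notin> A - (\<Union>k\<in>{m..}. E k)"
    unfolding AE_all_countable using null by blast
  moreover have "AE x in M. \<forall>\<^sub>F k in sequentially. x \<in> space M - E k"
  proof (rule borel_cantelli_AE1)
    show "emeasure M (E k) < \<infinity>" for k
      using E(2)[of k] by (rule le_less_trans) simp
    have "measure M (E k) \<le> (1/2)^k" for k
      using E(2)[of k] unfolding measure_def by (intro enn2real_leI) auto
    then show "summable (\<lambda>k. measure M (E k))"
      by (intro summable_comparison_test'[OF summable_geometric[of "1/2"], of 0]) auto
  qed (rule E)
  ultimately show ?thesis
    by eventually_elim (auto simp: eventually_sequentially)
qed

section \<open>Pointwise doubling\<close>

lemma locally_finite_countable_cover:
  fixes M :: "'a::second_countable_topology measure"
  assumes "locally_finite_borel_measure M"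
  obtains \<V> where "countable \<V>" "\<Union>\<V> = UNIV" "\<And>V. V \<in> \<V> \<Longrightarrow> open V \<and> emeasure M V < \<infinity>"
proof -
  define \<U> where "\<U> = {V :: 'a set. open V \<and> emeasure M V < \<infinity>}"
  obtain \<V> where \<V>: "\<V> \<subseteq> \<U>" "countable \<V>" "\<Union>\<V> = \<Union>\<U>"
    using Lindelof[of \<U>] unfolding \<U>_def by blast
  have "\<Union>\<U> = UNIV" using assms unfolding \<U>_def locally_finite_borel_measure_def by blast
  then show ?thesis using \<V> by (intro that[of \<V>]) (auto simp: \<U>_def)
qed

lemma not_doubling_obtains_radius:
  fixes M :: "'a::metric_space measure"
  assumes nd: "\<not> pointwise_doubling_at M x" and V: "open V" "x \<in> V" and \<epsilon>: "0 < \<epsilon>"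
  obtains r where "0 < r" "r \<le> \<epsilon>" "ball x (2 * r) \<subseteq> V"
    "ennreal K * emeasure M (ball x r) \<le> emeasure M (ball x (2 * r))"
proof -
  let ?q = "\<lambda>r. emeasure M (ball x (2 * r)) / emeasure M (ball x r)"
  obtain \<rho> where \<rho>: "0 < \<rho>" "ball x \<rho> \<subseteq> V" using V by (meson openE)
  have "\<not> (\<forall>\<^sub>F r in at_right 0. ?q r \<le> ennreal K)"
  proof
    assume "\<forall>\<^sub>F r in at_right 0. ?q r \<le> ennreal K"
    then have "Limsup (at_right 0) ?q \<le> ennreal K" by (rule Limsup_bounded)
    then show False using nd unfolding pointwise_doubling_at_def by (simp add: le_less_trans)
  qed
  moreover have "0 < min \<epsilon> (\<rho> / 2)" using \<epsilon> \<rho>(1) by simp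
  ultimately have "\<not> (\<forall>r>0. r < min \<epsilon> (\<rho> / 2) \<longrightarrow> ?q r \<le> ennreal K)"
    unfolding eventually_at_right_field by blast
  then obtain r where r: "0 < r" "r < min \<epsilon> (\<rho> / 2)" "ennreal K \<le> ?q r"
    by (auto simp: not_le less_imp_le)
  have "ball x (2 * r) \<subseteq> ball x \<rho>" using r by (intro subset_ball) simp
  then have sub: "ball x (2 * r) \<subseteq> V" using \<rho>(2) by blast
  \<comment> \<open>Measures 0 and \<open>\<infinity>\<close> do no harm, since \<open>a / b * b \<le> a\<close> holds throughout \<open>ennreal\<close>.\<close>
  have div: "a / b * b \<le> a" for a b :: ennreal
    by (cases "b = 0 \<or> b = top") (auto simp: ennreal_divide_times ennreal_divide_self top.not_eq_extremum)
  have "ennreal K * emeasure M (ball x r) \<le> ?q r * emeasure M (ball x r)"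
    using r(3) by (intro mult_right_mono) auto
  also have "\<dots> \<le> emeasure M (ball x (2 * r))" by (rule div)
  finally show ?thesis using that[of r] r sub by simp
qed

text \<open>
  In an open set \<open>V\<close> of finite measure, the bad double balls \<open>ball x (2 * r)\<close> are selected disjoint.
  Their inner balls \<open>ball x r\<close> have total measure at most \<open>measure M V / K\<close>, and they are the holes:
  a bad point lies in a double ball that meets a selected one of at least half its radius, so its
  distance to the centre of the latter is at most \<open>2 * (2 * r) + 2 * r = 6 * r\<close>.
\<close>

lemma doubling_of_porous_null:
  fixes M :: "'a::{metric_space, second_countable_topology} measure"
  assumes lf: "locally_finite_borel_measure M"
    and null: "\<And>S. porous 6 S \<Longrightarrow> AE x in M. x \<notin> S"
  shows "AE x in M. pointwise_doubling_at M x"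
proof -
  have sets: "sets M = sets borel" using lf unfolding locally_finite_borel_measure_def by blast
  define N where "N V = {x\<in>V. \<not> pointwise_doubling_at M x}" for V
  have local: "AE x in M. x \<notin> N V" if V: "open V" "emeasure M V < \<infinity>" for V
  proof (rule almost_porous_null[where c = 6, OF null])
    fix \<epsilon> :: real assume \<epsilon>: "0 < \<epsilon>"
    define v where "v = measure M V"
    define K where "K = (v + 1) / \<epsilon>"
    have v: "0 \<le> v" "emeasure M V = ennreal v"
      unfolding v_def using V(2) by (auto simp: emeasure_eq_ennreal_measure)
    have K: "0 < K" unfolding K_def using \<epsilon> v by simp
    have [measurable]: "V \<in> sets M" "ball x r \<in> sets M" for x r unfolding sets using V(1) by auto
    define Q where "Q x r \<longleftrightarrow> 0 < r \<and> r \<le> \<epsilon> \<and> ball x (2 * r) \<subseteq> V \<and>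
        ennreal K * emeasure M (ball x r) \<le> emeasure M (ball x (2 * r))" for x r
    have "\<exists>r. Q x r" if x: "x \<in> N V" for x
    proof -
      have nd: "\<not> pointwise_doubling_at M x" and "x \<in> V" using x unfolding N_def by auto
      obtain r where "0 < r" "r \<le> \<epsilon>" "ball x (2 * r) \<subseteq> V"
        "ennreal K * emeasure M (ball x r) \<le> emeasure M (ball x (2 * r))"
        by (rule not_doubling_obtains_radius[OF nd V(1) \<open>x \<in> V\<close> \<epsilon>])
      then show ?thesis unfolding Q_def by blast
    qed
    then obtain r where "\<And>x. x \<in> N V \<Longrightarrow> Q x (r x)" by metis
    then have r: "0 < r x" "r x \<le> \<epsilon>" "ball x (2 * r x) \<subseteq> V"
      "ennreal K * emeasure M (ball x (r x)) \<le> emeasure M (ball x (2 * r x))" if "x \<in> N V" for x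
      using that unfolding Q_def by auto
    define F where "F x = ball x (2 * r x)" for x
    have F_ne: "F x \<noteq> {}" if "x \<in> N V" for x unfolding F_def using r(1)[OF that] by simp
    obtain C where C: "C \<subseteq> N V" "disjoint_family_on F C"
      and dom: "\<And>x. x \<in> N V \<Longrightarrow> \<exists>y\<in>C. F x \<inter> F y \<noteq> {} \<and> r x \<le> 2 * r y"
    proof (rule vitali_selection[of "N V" F r \<epsilon>, OF F_ne r(1,2)])
      fix C assume "C \<subseteq> N V" "disjoint_family_on F C"
        "\<And>x. x \<in> N V \<Longrightarrow> \<exists>y\<in>C. F x \<inter> F y \<noteq> {} \<and> r x \<le> 2 * r y"
      then show thesis by (rule that)
    qed
    have small: "ball x (r x) \<subseteq> F x" if "x \<in> C" for x
      unfolding F_def using r(1)[OF subsetD[OF C(1) that]] by (intro subset_ball) simp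
    have disj: "disjoint_family_on (\<lambda>x. ball x (r x)) C"
      using C(2) small unfolding disjoint_family_on_def by blast
    have "countable C"
    proof (rule countable_image_inj_on)
      show "countable (F ` C)"
        using disjoint_family_on_disjoint_image[OF C(2)]
        by (intro countable_disjoint_open_subsets) (auto simp: F_def)
      show "inj_on F C"
      proof (rule inj_onI, rule ccontr)
        fix x y assume xy: "x \<in> C" "y \<in> C" "F x = F y" "x \<noteq> y"
        then have "F x = {}" using C(2) unfolding disjoint_family_on_def by blast
        then show False using F_ne xy(1) C(1) by blast
      qed
    qed
    define E where "E = (\<Union>x\<in>C. ball x (r x))"
    have E[measurable]: "E \<in> sets M" unfolding E_def using \<open>countable C\<close> by (intro sets.countable_UN') auto
    have "ennreal K * emeasure M E = (\<integral>\<^sup>+x. ennreal K * emeasure M (ball x (r x)) \<partial>count_space C)"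
      unfolding E_def using \<open>countable C\<close> disj by (subst emeasure_UN_countable) (auto simp: nn_integral_cmult)
    also have "\<dots> \<le> (\<integral>\<^sup>+x. emeasure M (F x) \<partial>count_space C)"
      using C(1) r(4) unfolding F_def by (intro nn_integral_mono) auto
    also have "\<dots> = emeasure M (\<Union>x\<in>C. F x)"
      using \<open>countable C\<close> C(2) by (subst emeasure_UN_countable) (auto simp: F_def)
    also have "\<dots> \<le> ennreal v"
      unfolding v(2)[symmetric] using C(1) r(3) unfolding F_def by (intro emeasure_mono) auto
    finally have KE: "ennreal K * emeasure M E \<le> ennreal v" .
    have "E \<subseteq> V" unfolding E_def using small C(1) r(3) unfolding F_def by blast
    then have "emeasure M E < \<infinity>" using V(2) by (meson emeasure_mono \<open>V \<in> sets M\<close> le_less_trans)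
    then have mE: "emeasure M E = ennreal (measure M E)" by (simp add: emeasure_eq_ennreal_measure)
    have "K * measure M E \<le> v"
      using KE K v(1) unfolding mE by (simp add: ennreal_mult[symmetric])
    then have "measure M E * (v + 1) \<le> \<epsilon> * v" using \<epsilon> unfolding K_def by (simp add: field_simps)
    also have "\<dots> \<le> \<epsilon> * (v + 1)" using \<epsilon> by simp
    finally have "emeasure M E \<le> ennreal \<epsilon>"
      unfolding mE using v(1) by (intro ennreal_leI) simp
    moreover have "\<exists>y\<in>C. dist x y \<le> 6 * r y" if x: "x \<in> N V" for x
    proof -
      obtain y z where y: "y \<in> C" "r x \<le> 2 * r y" and z: "dist x z < 2 * r x" "dist y z < 2 * r y"
        using dom[OF x] unfolding F_def by fastforce
      have "dist x y \<le> dist x z + dist y z" by (rule dist_triangle2)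
      then show ?thesis using y z by force
    qed
    ultimately show "\<exists>H E. E \<in> sets M \<and> emeasure M E \<le> ennreal \<epsilon> \<and>
        (\<forall>(y, s)\<in>H. 0 < s \<and> s \<le> \<epsilon> \<and> ball y s \<inter> N V \<subseteq> E) \<and> (\<forall>x\<in>N V. \<exists>(y, s)\<in>H. dist x y \<le> 6 * s)"
      using C(1) r(1,2) E
      by (intro exI[of _ "(\<lambda>y. (y, r y)) ` C"] exI[of _ E]) (auto simp: E_def)
  qed
  obtain \<V> where \<V>: "countable \<V>" "\<Union>\<V> = UNIV" "\<And>V. V \<in> \<V> \<Longrightarrow> open V \<and> emeasure M V < \<infinity>"
    by (rule locally_finite_countable_cover[OF lf]) blast
  have "AE x in M. \<forall>V\<in>\<V>. x \<notin> N V"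
    using local \<V>(1,3) by (subst AE_ball_countable) auto
  then show ?thesis
    by eventually_elim (use \<V>(2) in \<open>auto simp: N_def\<close>)
qed

section \<open>The Vitali covering property\<close>

lemma (in finite_measure) countable_union_finite_approx:
  assumes D: "countable \<D>" "\<D> \<subseteq> sets M" and \<epsilon>: "0 < (\<epsilon>::real)"
  obtains \<F> where "finite \<F>" "\<F> \<subseteq> \<D>" "emeasure M (\<Union>\<D> - \<Union>\<F>) \<le> ennreal \<epsilon>"
proof (cases "\<D> = {}")
  case True
  then show ?thesis using that[of "{}"] by simp
next
  case False
  define B where "B n = \<Union>\<D> - \<Union>(from_nat_into \<D> ` {..<n})" for n
  have rng: "range (from_nat_into \<D>) = \<D>" using False D(1) by (rule range_from_nat_into)
  have "\<Union>\<D> \<in> sets M" using D by (intro sets.countable_Union)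
  moreover have "\<Union>(from_nat_into \<D> ` {..<n}) \<in> sets M" for n
    using D(2) rng by (intro sets.finite_Union) auto
  ultimately have "range B \<subseteq> sets M" unfolding B_def by auto
  moreover have "decseq B" unfolding B_def decseq_def by auto
  moreover have "(\<Inter>n. B n) = {}"
  proof -
    have False if x: "\<And>n. x \<in> B n" for x
    proof -
      have "x \<in> \<Union>(range (from_nat_into \<D>))" using x[of 0] unfolding B_def rng by auto
      then obtain i where "x \<in> from_nat_into \<D> i" by blast
      then show False using x[of "Suc i"] unfolding B_def by auto
    qed
    then show ?thesis by blast
  qed
  ultimately have "(\<lambda>n. measure M (B n)) \<longlonglongrightarrow> 0" using finite_Lim_measure_decseq[of B] by simp
  then have "\<forall>\<^sub>F n in sequentially. measure M (B n) < \<epsilon>" using \<epsilon> by (rule order_tendstoD)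
  then obtain n where "measure M (B n) < \<epsilon>" by (auto simp: eventually_sequentially)
  then have "emeasure M (B n) \<le> ennreal \<epsilon>"
    by (simp add: emeasure_eq_measure ennreal_leI)
  then show ?thesis
    using that[of "from_nat_into \<D> ` {..<n}"] rng unfolding B_def by auto
qed

text \<open>
  The covering is built in stages.  Only finitely many balls are kept at each stage so that their union
  stays closed: a point outside it then has small balls of \<open>\<B>\<close> that avoid it, which makes the next
  stage possible.  The predicate \<open>holes P P' \<epsilon>\<close> records what a stage from \<open>P\<close> to \<open>P'\<close> provides: balls of
  radius at most \<open>\<epsilon>\<close> that are covered by \<open>P'\<close> up to measure \<open>\<epsilon>\<close>, and whose enlargements cover what
  \<open>P\<close> left of \<open>A\<close>.
\<close>

lemma vitali_of_porous_null:
  fixes M :: "'a::{metric_space, second_countable_topology} measure"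
  assumes fin: "finite_measure M" and sets: "sets M = sets borel"
    and null: "\<And>S. porous 6 S \<Longrightarrow> AE x in M. x \<notin> S"
  shows "vitali_space M"
  unfolding vitali_space_def
proof (intro allI impI, elim conjE)
  fix A :: "'a set" and \<B> :: "'a set set"
  assume \<B>: "\<B> \<subseteq> {cball x r | x r. x \<in> A \<and> r > 0}"
    and inf: "\<forall>x\<in>A. (INF r\<in>{r. r > 0 \<and> cball x r \<in> \<B>}. ereal r) = 0"
  interpret finite_measure M by (rule fin)
  have fine: "\<exists>r. 0 < r \<and> r < \<rho> \<and> cball x r \<in> \<B>" if "x \<in> A" "0 < \<rho>" for x \<rho>
  proof -
    have "(INF r\<in>{r. r > 0 \<and> cball x r \<in> \<B>}. ereal r) < ereal \<rho>" using inf that by simp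
    then show ?thesis unfolding INF_less_iff by auto
  qed
  define holes where "holes P P' \<epsilon> \<longleftrightarrow> (\<exists>H E. E \<in> sets M \<and> emeasure M E \<le> ennreal \<epsilon> \<and>
      (\<forall>(y, s)\<in>H. 0 < s \<and> s \<le> \<epsilon> \<and> ball y s \<subseteq> \<Union>P' \<union> E) \<and>
      (\<forall>x\<in>A - \<Union>P. \<exists>(y, s)\<in>H. dist x y \<le> 6 * s))" for P P' and \<epsilon> :: real
  define good where "good P \<longleftrightarrow> finite P \<and> P \<subseteq> \<B> \<and> disjoint P" for P
  have extend: "\<exists>P'. good P' \<and> P \<subseteq> P' \<and> holes P P' \<epsilon>" if P: "good P" and \<epsilon>: "0 < \<epsilon>" for P \<epsilon>
  proof -
    have finP: "finite P" and PB: "P \<subseteq> \<B>" and disjP: "disjoint P" using P unfolding good_def by auto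
    define K where "K = {(x, s). x \<in> A \<and> 0 < s \<and> s \<le> \<epsilon> \<and> cball x s \<in> \<B> \<and> cball x s \<inter> \<Union>P = {}}"
    define F :: "'a \<times> real \<Rightarrow> 'a set" where "F p = cball (fst p) (snd p)" for p
    \<comment> \<open>Balls are indexed by centre and radius, which the set alone need not determine.\<close>
    obtain D where D: "D \<subseteq> K" "disjoint_family_on F D"
      and dom: "\<And>p. p \<in> K \<Longrightarrow> \<exists>q\<in>D. F p \<inter> F q \<noteq> {} \<and> snd p \<le> 2 * snd q"
    proof (rule vitali_selection[of K F snd \<epsilon>])
      show "F p \<noteq> {}" "0 < snd p" "snd p \<le> \<epsilon>" if "p \<in> K" for p
        using that unfolding K_def F_def by auto
    qed blast
    have disjD: "disjoint (F ` D)" by (rule disjoint_family_on_disjoint_image[OF D(2)])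
    have "countable (F ` D)"
    proof (rule countable_disjoint_nonempty_interior_subsets[OF disjD])
      fix S assume S: "S \<in> F ` D" "interior S = {}"
      then obtain x s where xs: "S = cball x s" "0 < s" using D(1) unfolding F_def K_def by auto
      have "ball x s \<subseteq> interior S" unfolding xs(1) by (intro interior_maximal) auto
      then show "S = {}" using S(2) xs(2) by auto
    qed
    moreover have "F ` D \<subseteq> sets M" unfolding sets F_def by auto
    ultimately obtain Q where Q: "finite Q" "Q \<subseteq> F ` D" "emeasure M (\<Union>(F ` D) - \<Union>Q) \<le> ennreal \<epsilon>"
      using countable_union_finite_approx \<epsilon> by metis
    define E where "E = \<Union>(F ` D) - \<Union>Q"
    have "E \<in> sets M"
      unfolding E_def using \<open>countable (F ` D)\<close> \<open>F ` D \<subseteq> sets M\<close> Q(1,2)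
      by (intro sets.Diff sets.countable_Union sets.finite_Union) auto
    have FD: "F q \<in> \<B>" "F q \<inter> \<Union>P = {}" if "q \<in> D" for q
      using subsetD[OF D(1) that] unfolding K_def F_def split_beta by auto
    have "good (P \<union> Q)"
      unfolding good_def
    proof (intro conjI)
      show "P \<union> Q \<subseteq> \<B>" using PB Q(2) FD(1) by blast
      have "X \<inter> Y = {}" if "X \<in> P" "Y \<in> Q" for X Y using that Q(2) FD(2) by blast
      then have "\<Union>P \<inter> \<Union>Q = {}" by blast
      then show "disjoint (P \<union> Q)"
        by (rule disjoint_union[OF disjP pairwise_subset[OF disjD Q(2)]])
    qed (use finP Q(1) in simp)
    moreover have "holes P (P \<union> Q) \<epsilon>"
      unfolding holes_def
    proof (intro exI conjI)
      show "E \<in> sets M" "emeasure M E \<le> ennreal \<epsilon>" using Q(3) \<open>E \<in> sets M\<close> unfolding E_def by auto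
      show "\<forall>(y, s)\<in>D. 0 < s \<and> s \<le> \<epsilon> \<and> ball y s \<subseteq> \<Union>(P \<union> Q) \<union> E"
      proof clarify
        fix y s assume ys: "(y, s) \<in> D"
        have "ball y s \<subseteq> \<Union>(F ` D)" using ys ball_subset_cball unfolding F_def by force
        then show "0 < s \<and> s \<le> \<epsilon> \<and> ball y s \<subseteq> \<Union>(P \<union> Q) \<union> E"
          using ys D(1) unfolding K_def E_def by auto
      qed
      show "\<forall>x\<in>A - \<Union>P. \<exists>(y, s)\<in>D. dist x y \<le> 6 * s"
      proof
        fix x assume x: "x \<in> A - \<Union>P"
        have "closed (\<Union>P)" using finP PB \<B> by (intro closed_Union) auto
        then obtain \<rho> where \<rho>: "0 < \<rho>" "ball x \<rho> \<inter> \<Union>P = {}"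
          using x by (metis ComplI Diff_iff disjoint_eq_subset_Compl open_Compl openE)
        obtain r where r: "0 < r" "r < min \<rho> \<epsilon>" "cball x r \<in> \<B>"
          using fine[of x "min \<rho> \<epsilon>"] x \<rho>(1) \<epsilon> by auto
        have "cball x r \<subseteq> ball x \<rho>" using r(2) by auto
        then have "(x, r) \<in> K" using x r \<rho>(2) unfolding K_def by auto
        from dom[OF this] obtain y s z where ys: "(y, s) \<in> D" "r \<le> 2 * s"
          and z: "dist x z \<le> r" "dist y z \<le> s" unfolding F_def by fastforce
        have "dist x y \<le> dist x z + dist y z" by (rule dist_triangle2)
        then have "dist x y \<le> 6 * s" using ys(2) z r(1) by linarith
        then show "\<exists>(y, s)\<in>D. dist x y \<le> 6 * s" using ys(1) by blast
      qed
    qed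
    ultimately show ?thesis by blast
  qed
  have "\<exists>P. \<forall>k. good (P k) \<and> P k \<subseteq> P (Suc k) \<and> holes (P k) (P (Suc k)) (1 / real (Suc k))"
  proof (rule dependent_nat_choice)
    show "\<exists>P. good P" by (rule exI[of _ "{}"]) (simp add: good_def)
    show "\<exists>P'. good P' \<and> P \<subseteq> P' \<and> holes P P' (1 / real (Suc k))" if "good P" for P k
      using extend[OF that] by simp
  qed
  then obtain P where good: "\<And>k. good (P k)" and inc: "\<And>k. P k \<subseteq> P (Suc k)"
    and hol: "\<And>k. holes (P k) (P (Suc k)) (1 / real (Suc k))" by blast
  have mono: "P k \<subseteq> P m" if "k \<le> m" for k m using inc that by (rule lift_Suc_mono_le)
  define \<C> where "\<C> = (\<Union>k. P k)"
  have "AE x in M. x \<notin> A - \<Union>\<C>"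
  proof (rule almost_porous_null[where c = 6, OF null])
    fix \<epsilon> :: real assume "0 < \<epsilon>"
    then obtain k where k: "1 / real (Suc k) < \<epsilon>" using nat_approx_posE by blast
    obtain H E where E: "E \<in> sets M" "emeasure M E \<le> ennreal (1 / real (Suc k))"
      and H: "\<forall>(y, s)\<in>H. 0 < s \<and> s \<le> 1 / real (Suc k) \<and> ball y s \<subseteq> \<Union>(P (Suc k)) \<union> E"
      and near: "\<forall>x\<in>A - \<Union>(P k). \<exists>(y, s)\<in>H. dist x y \<le> 6 * s"
      using hol[of k] unfolding holes_def by blast
    have "P k \<subseteq> \<C>" "P (Suc k) \<subseteq> \<C>" unfolding \<C>_def by auto
    have "emeasure M E \<le> ennreal \<epsilon>" using E(2) k by (meson ennreal_leI less_imp_le order_trans)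
    moreover have "\<forall>(y, s)\<in>H. 0 < s \<and> s \<le> \<epsilon> \<and> ball y s \<inter> (A - \<Union>\<C>) \<subseteq> E"
    proof clarify
      fix y s assume "(y, s) \<in> H"
      then have "0 < s" "s \<le> 1 / real (Suc k)" "ball y s \<subseteq> \<Union>(P (Suc k)) \<union> E" using H by auto
      then show "0 < s \<and> s \<le> \<epsilon> \<and> ball y s \<inter> (A - \<Union>\<C>) \<subseteq> E"
        using k \<open>P (Suc k) \<subseteq> \<C>\<close> by auto
    qed
    moreover have "\<forall>x\<in>A - \<Union>\<C>. \<exists>(y, s)\<in>H. dist x y \<le> 6 * s" using near \<open>P k \<subseteq> \<C>\<close> by blast
    ultimately show "\<exists>H E. E \<in> sets M \<and> emeasure M E \<le> ennreal \<epsilon> \<and>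
        (\<forall>(y, s)\<in>H. 0 < s \<and> s \<le> \<epsilon> \<and> ball y s \<inter> (A - \<Union>\<C>) \<subseteq> E) \<and>
        (\<forall>x\<in>A - \<Union>\<C>. \<exists>(y, s)\<in>H. dist x y \<le> 6 * s)"
      using E(1) by blast
  qed
  then have "AE x in M. x \<in> A \<longrightarrow> x \<in> \<Union>\<C>" by eventually_elim blast
  moreover have "\<C> \<subseteq> \<B>" "countable \<C>"
    using good unfolding \<C>_def good_def by (auto intro: countable_finite)
  moreover have "disjoint \<C>"
    unfolding disjoint_def
  proof (intro ballI impI)
    fix X Y assume "X \<in> \<C>" "Y \<in> \<C>" "X \<noteq> Y"
    then obtain k m where "X \<in> P k" "Y \<in> P m" unfolding \<C>_def by blast
    then have "X \<in> P (max k m)" "Y \<in> P (max k m)"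
      using mono[of k "max k m"] mono[of m "max k m"] by auto
    then show "X \<inter> Y = {}" using good[of "max k m"] \<open>X \<noteq> Y\<close> unfolding good_def disjoint_def by blast
  qed
  ultimately show "\<exists>\<C>\<subseteq>\<B>. countable \<C> \<and> disjoint \<C> \<and> (AE x in M. x \<in> A \<longrightarrow> x \<in> \<Union>\<C>)" by blast
qed

section \<open>Differentiability spaces\<close>

text \<open>
  Differentiability and the Vitali property depend only on the null sets, so \<open>M\<close> may be replaced by an
  equivalent finite measure \<open>N\<close>.  Doubling does depend on the measure itself, and is proved for \<open>M\<close>.
\<close>

theorem corollary2p6:
  fixes M :: "'a::{complete_space, second_countable_topology} measure"
  assumes "locally_finite_borel_measure M"
    and "differentiability_space M"
  shows "(AE x in M. pointwise_doubling_at M x) \<and> vitali_space M"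
proof -
  have sets: "sets M = sets borel" using assms(1) unfolding locally_finite_borel_measure_def by blast
  have space: "space M = UNIV" using sets_eq_imp_space_eq[OF sets] by simp
  obtain \<V> where "countable \<V>" "\<Union>\<V> = UNIV" "\<And>V. V \<in> \<V> \<Longrightarrow> open V \<and> emeasure M V < \<infinity>"
    by (rule locally_finite_countable_cover[OF assms(1)]) blast
  then have "sigma_finite_measure M"
    by (intro sigma_finite_measure.intro exI[of _ \<V>]) (auto simp: sets space less_top)
  then obtain w where w: "w \<in> borel_measurable M" "integral\<^sup>N M w \<noteq> \<infinity>" "\<And>x. 0 < w x"
    using sigma_finite_measure.Ex_finite_integrable_function[of M] space by auto
  define N where "N = density M w"
  have AE_N: "(AE x in N. Q x) \<longleftrightarrow> (AE x in M. Q x)" for Q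
    unfolding N_def AE_density[OF w(1)] using w(3) by simp
  have finN: "finite_measure N"
    using w(1,2) unfolding N_def by (intro finite_measureI) (simp add: emeasure_density cong: nn_integral_cong)
  have setsN: "sets N = sets borel" unfolding N_def using sets by simp
  have "differentiability_space N"
    using assms(2) unfolding differentiability_space_def AE_N .
  then have nullN: "AE x in N. x \<notin> S" if "porous 6 S" for S
    using porous_null[OF finN setsN _ that] by blast
  have "vitali_space N" by (rule vitali_of_porous_null[OF finN setsN nullN])
  then have "vitali_space M" unfolding vitali_space_def AE_N .
  moreover have "AE x in M. pointwise_doubling_at M x"
    using nullN unfolding AE_N by (rule doubling_of_porous_null[OF assms(1)])
  ultimately show ?thesis by blast
qed

end
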